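(* Let $T$ be a tree with root $o$, $\pi:T\to(0,\infty)$ a weight, $1<p<\infty$, $\frac1p+\frac1{p'}=1$. Let $Z$ be a set in $\overline T$, let $x_0$ be a point in $T$ and let $x_1,\dots,x_n$ be its children. For each $j$ let $Z_j=Z\cap S(x_j)$. If $\mathrm{Cap}_{x_j}$ denotes the capacity with respect to the root $x_j$ (i.e. in the subtree $S(x_j)$), then $$\mathrm{Cap}(Z)=\frac{\sum_j\mathrm{Cap}_{x_j}(Z_j)}{\left\{1+d_\pi(x_0)\left(\sum_j\mathrm{Cap}_{x_j}(Z_j)\right)^{p'-1}\right\}^{p-1}}.$$
   Context: $T$ is a rooted tree with root $o$ in which every vertex has at least one and at most $N$ children ($N$ finite); $\partial T$ is the set of infinite geodesics starting at $o$, and $\overline T=T\cup\partial T$. For $\xi\in\overline T$, $P(\xi)\subseteq T$ is the set of vertices of the geodesic from $o$ to $\xi$ (including $o$, and $\xi$ itself if $\xi\in T$). For $x\in T$, $S(x)=\{\xi\in\overline T:\ x\in P(\xi)\}$ (so $x\in S(x)$). $d_\pi(x)=\sum_{y\in P(x)}\pi(y)^{1-p'}$. Capacity of $E\subseteq\overline T$: $\mathrm{Cap}(E)=\inf\{\sum_{x\in T}\varphi(x)^p\pi(x):\ \varphi:T\to[0,\infty),\ \sum_{y\in P(\xi)}\varphi(y)\ge1\ \forall\xi\in E\}$. For $a\in T$ and $E\subseteq S(a)$: $\mathrm{Cap}_a(E)=\inf\{\sum_{x\in T\cap S(a)}\varphi(x)^p\pi(x):\ \varphi:T\cap S(a)\to[0,\infty),\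 \sum_{y\in P(\xi)\cap S(a)}\varphi(y)\ge1\ \forall\xi\in E\}$.
   Formalization: The set Z is additionally assumed to be contained in the union of the S(x_j), i.e. Z is the union of the Z_j; without this the formula fails, e.g. for Z={o}, x_0=o, where the right side is 0 but Cap(Z)=π(o)>0. *)

theory Defs
  imports "HOL-Analysis.Analysis"
begin

text \<open>A simple graph is given by a vertex set \<open>T\<close> and a symmetric, irreflexive set \<open>E\<close> of ordered
  pairs of vertices.\<close>

definition path_between :: "('a \<times> 'a) set \<Rightarrow> 'a \<Rightarrow> 'a \<Rightarrow> 'a list \<Rightarrow> bool" where
  "path_between E x y xs \<longleftrightarrow>
     xs \<noteq> [] \<and> hd xs = x \<and> last xs = y \<and> distinct xs \<and> successively (\<lambda>u v. (u, v) \<in> E) xs"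

definition is_tree :: "'a set \<Rightarrow> ('a \<times> 'a) set \<Rightarrow> bool" where
  "is_tree T E \<longleftrightarrow> E \<subseteq> T \<times> T \<and> sym E \<and> irrefl E \<and>
     (\<forall>x\<in>T. \<forall>y\<in>T. \<exists>!xs. path_between E x y xs)"

text \<open>In a tree the unique path without repetitions between two vertices is the geodesic, so
  an infinite geodesic from the root \<open>r\<close> is an injective sequence of successively adjacent vertices.\<close>

definition tree_boundary :: "('a \<times> 'a) set \<Rightarrow> 'a \<Rightarrow> (nat \<Rightarrow> 'a) set" where
  "tree_boundary E r = {\<gamma>. \<gamma> 0 = r \<and> inj \<gamma> \<and> (\<forall>n. (\<gamma> n, \<gamma> (Suc n)) \<in> E)}"

text \<open>Points of the completed tree are \<open>Inl x\<close> for a vertex \<open>x\<close>, and \<open>Inr \<gamma>\<close> for a boundary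
  point \<open>\<gamma>\<close>.\<close>

definition tree_closure :: "'a set \<Rightarrow> ('a \<times> 'a) set \<Rightarrow> 'a \<Rightarrow> ('a + (nat \<Rightarrow> 'a)) set" where
  "tree_closure T E r = Inl ` T \<union> Inr ` tree_boundary E r"

definition predecessors :: "('a \<times> 'a) set \<Rightarrow> 'a \<Rightarrow> 'a + (nat \<Rightarrow> 'a) \<Rightarrow> 'a set" where
  "predecessors E r \<xi> =
     (case \<xi> of Inl x \<Rightarrow> {y. \<exists>xs. path_between E r x xs \<and> y \<in> set xs} | Inr \<gamma> \<Rightarrow> range \<gamma>)"

definition successors :: "'a set \<Rightarrow> ('a \<times> 'a) set \<Rightarrow> 'a \<Rightarrow> 'a \<Rightarrow> ('a + (nat \<Rightarrow> 'a)) set" where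
  "successors T E r x = {\<xi> \<in> tree_closure T E r. x \<in> predecessors E r \<xi>}"

definition successor_vertices :: "'a set \<Rightarrow> ('a \<times> 'a) set \<Rightarrow> 'a \<Rightarrow> 'a \<Rightarrow> 'a set" where
  "successor_vertices T E r x = {y \<in> T. Inl y \<in> successors T E r x}"

definition children :: "('a \<times> 'a) set \<Rightarrow> 'a \<Rightarrow> 'a \<Rightarrow> 'a set" where
  "children E r x = {y. (x, y) \<in> E \<and> x \<in> predecessors E r (Inl y)}"

definition rooted_tree :: "'a set \<Rightarrow> ('a \<times> 'a) set \<Rightarrow> 'a \<Rightarrow> nat \<Rightarrow> bool" where
  "rooted_tree T E r N \<longleftrightarrow> is_tree T E \<and> r \<in> T \<and>
     (\<forall>x\<in>T. finite (children E r x) \<and> 1 \<le> card (children E r x) \<and> card (children E r x) \<le> N)"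

definition d_weight :: "('a \<times> 'a) set \<Rightarrow> 'a \<Rightarrow> real \<Rightarrow> ('a \<Rightarrow> real) \<Rightarrow> 'a \<Rightarrow> real" where
  "d_weight E r p' w x = (\<Sum>y\<in>predecessors E r (Inl x). w y powr (1 - p'))"

text \<open>The sums are taken in \<open>ennreal\<close>, so that a divergent sum has the value \<open>\<infinity>\<close>.\<close>

definition capacity ::
  "'a set \<Rightarrow> ('a \<times> 'a) set \<Rightarrow> 'a \<Rightarrow> real \<Rightarrow> ('a \<Rightarrow> real) \<Rightarrow> ('a + (nat \<Rightarrow> 'a)) set \<Rightarrow> ennreal" where
  "capacity T E r p w Z =
     (INF \<phi> \<in> {\<phi>. (\<forall>x\<in>T. 0 \<le> \<phi> x) \<and>
                    (\<forall>\<xi>\<in>Z. 1 \<le> (\<Sum>\<^sub>\<infinity>y\<in>predecessors E r \<xi>. ennreal (\<phi> y)))}.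
        \<Sum>\<^sub>\<infinity>x\<in>T. ennreal (\<phi> x powr p * w x))"

definition capacity_at ::
  "'a set \<Rightarrow> ('a \<times> 'a) set \<Rightarrow> 'a \<Rightarrow> real \<Rightarrow> ('a \<Rightarrow> real) \<Rightarrow> 'a \<Rightarrow> ('a + (nat \<Rightarrow> 'a)) set \<Rightarrow> ennreal" where
  "capacity_at T E r p w a Z =
     (INF \<phi> \<in> {\<phi>. (\<forall>x\<in>successor_vertices T E r a. 0 \<le> \<phi> x) \<and>
                    (\<forall>\<xi>\<in>Z. 1 \<le> (\<Sum>\<^sub>\<infinity>y\<in>predecessors E r \<xi> \<inter> successor_vertices T E r a. ennreal (\<phi> y)))}.
        \<Sum>\<^sub>\<infinity>x\<in>successor_vertices T E r a. ennreal (\<phi> x powr p * w x))"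

text \<open>The capacity with respect to a vertex is finite, so \<open>enn2real\<close> may be applied to it without
  losing information.\<close>

lemma capacity_at_finite:
  fixes w :: "'a \<Rightarrow> real"
  assumes "rooted_tree T E r N" and "a \<in> T" and "Z \<subseteq> successors T E r a"
  shows "capacity_at T E r p w a Z < \<infinity>"
proof -
  define f :: "'a \<Rightarrow> real" where "f = (\<lambda>x. if x = a then 1 else 0)"
  let ?V = "successor_vertices T E r a"
  obtain xs where xs: "path_between E r a xs"
    using assms unfolding rooted_tree_def is_tree_def by blast
  then have "a \<in> predecessors E r (Inl a)"
    unfolding predecessors_def path_between_def by (auto intro!: exI[of _ xs])
  then have a: "a \<in> ?V"
    using assms(2) by (auto simp: successor_vertices_def successors_def tree_closure_def)
  have "(\<Sum>\<^sub>\<infinity>y\<in>predecessors E r \<xi> \<inter> ?V. ennreal (f y)) = 1" if "\<xi> \<in> Z" for \<xi>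
  proof -
    have "a \<in> predecessors E r \<xi> \<inter> ?V"
      using that assms(3) a by (auto simp: successors_def)
    then have "(\<Sum>\<^sub>\<infinity>y\<in>predecessors E r \<xi> \<inter> ?V. ennreal (f y)) = (\<Sum>\<^sub>\<infinity>y\<in>{a}. ennreal (f y))"
      by (intro infsum_cong_neutral) (auto simp: f_def)
    then show ?thesis by (simp add: f_def)
  qed
  then have "capacity_at T E r p w a Z \<le> (\<Sum>\<^sub>\<infinity>x\<in>?V. ennreal (f x powr p * w x))"
    unfolding capacity_at_def by (intro INF_lower) (auto simp: f_def)
  also have "\<dots> = (\<Sum>\<^sub>\<infinity>x\<in>{a}. ennreal (f x powr p * w x))"
    using a by (intro infsum_cong_neutral) (auto simp: f_def)
  also have "\<dots> < \<infinity>" by simp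
  finally show ?thesis .
qed

end

theory Submission
  imports Defs
begin

text \<open>The geodesic from the root to a point of \<open>Z\<close> below the child \<open>y\<close> of \<open>x\<^sub>0\<close> consists of the
  geodesic \<open>P\<close> to \<open>x\<^sub>0\<close> followed by a part inside the subtree of \<open>y\<close>. Suppose that \<open>\<phi>\<close> has
  total \<open>t < 1\<close> on \<open>P\<close>. By Hoelder's inequality its energy on \<open>P\<close> is at least
  \<open>t powr p * d powr (1 - p)\<close>, with equality for \<open>\<phi>\<close> proportional to \<open>w powr (1 - p')\<close>; on the
  subtrees, \<open>\<phi> / (1 - t)\<close> is admissible, so the energy there is at least \<open>(1 - t) powr p * s\<close>,
  which can be approached. Hence the capacity is the minimum over \<open>t\<close> of
  \<open>t powr p * d powr (1 - p) + (1 - t) powr p * s\<close>, and the lower bound for this minimum is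
  Hoelder's inequality again, for two points of weights \<open>d powr (1 - p)\<close> and \<open>s\<close>.\<close>

section \<open>Hoelder's inequality and the minimum problem for two conductors\<close>

lemma conjugate_exponent_eq:
  fixes p p' :: real
  assumes "1 < p" "1 / p + 1 / p' = 1"
  shows "p' = p / (p - 1)"
proof -
  \<comment> \<open>Division by zero gives \<open>1 / 0 = 0\<close>, so \<open>p' = 0\<close> would
    force \<open>p = 1\<close>.\<close>
  have "p' \<noteq> 0" using assms by auto
  then show ?thesis using assms by (simp add: field_simps)
qed

text \<open>This is Jensen's inequality for the convex function \<open>x powr p\<close>, taken at
  the points \<open>f i / a i\<close> with the probability weights \<open>a i\<close> proportional
  to \<open>w i powr (1 - p')\<close>.\<close>

lemma weighted_Holder_sum:
  fixes p p' :: real and w f :: "'i \<Rightarrow> real"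
  assumes p: "1 < p" "1 / p + 1 / p' = 1" and S: "finite S"
    and w: "\<And>i. i \<in> S \<Longrightarrow> 0 < w i" and f: "\<And>i. i \<in> S \<Longrightarrow> 0 \<le> f i"
  shows "(\<Sum>i\<in>S. f i) powr p \<le>
    (\<Sum>i\<in>S. f i powr p * w i) * (\<Sum>i\<in>S. w i powr (1 - p')) powr (p - 1)"
proof -
  \<comment> \<open>Convexity of \<open>x powr p\<close> is available only on the positive reals, so zeros of \<open>f\<close> are discarded.\<close>
  define R where "R = {i \<in> S. 0 < f i}"
  define d where "d = (\<Sum>i\<in>R. w i powr (1 - p'))"
  have R: "finite R" "R \<subseteq> S" using S by (auto simp: R_def)
  have sumR: "(\<Sum>i\<in>S. f i) = (\<Sum>i\<in>R. f i)"
    using S f by (intro sum.mono_neutral_right) (force simp: R_def)+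
  have p': "p' = p / (p - 1)" using conjugate_exponent_eq[OF p] .
  \<comment> \<open>The exponents \<open>1 - p'\<close> and \<open>1 - p\<close> are reciprocal, so
    \<open>a i powr (1 - p)\<close> is \<open>w i\<close> times a power of \<open>d\<close>.\<close>
  have e: "(1 - p') * (1 - p) = 1" using p(1) unfolding p' by (simp add: field_simps)
  show ?thesis
  proof (cases "R = {}")
    case True
    then show ?thesis using sumR p w f
      by (simp add: sum_nonneg less_imp_le)
  next
    case False
    have d: "0 < d" unfolding d_def using R False w by (intro sum_pos) (auto simp: less_imp_neq[symmetric] subset_iff)
    define a where "a i = w i powr (1 - p') / d" for i
    have a: "0 < a i" if "i \<in> R" for i
    proof -
      have "0 < w i" using that R w by auto
      then show ?thesis using d by (simp add: a_def)
    qed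
    have suma: "(\<Sum>i\<in>R. a i) = 1" using d by (simp add: a_def d_def flip: sum_divide_distrib)
    have "(\<Sum>i\<in>R. a i *\<^sub>R (f i / a i)) powr p \<le> (\<Sum>i\<in>R. a i * (f i / a i) powr p)"
      using R False p a suma by (intro convex_on_sum[OF _ _ powr_convex]) (auto simp: R_def less_imp_le)
    also have "(\<Sum>i\<in>R. a i *\<^sub>R (f i / a i)) = (\<Sum>i\<in>R. f i)"
      using a by (intro sum.cong) (auto simp: less_imp_neq[symmetric] dest: a)
    also have "(\<Sum>i\<in>R. a i * (f i / a i) powr p) = (\<Sum>i\<in>R. f i powr p * w i * d powr (p - 1))"
    proof (intro sum.cong refl)
      fix i assume i: "i \<in> R"
      then have wi: "0 < w i" and fi: "0 < f i" using R w by (auto simp: R_def)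
      have "a i * (f i / a i) powr p = f i powr p * a i powr (1 - p)"
        using a[OF i] fi by (simp add: powr_divide powr_diff)
      also have "a i powr (1 - p) = w i powr ((1 - p') * (1 - p)) / d powr (1 - p)"
        using wi d by (simp add: a_def powr_divide powr_powr)
      also have "\<dots> = w i * d powr (p - 1)"
        using wi d by (simp add: e powr_diff)
      finally show "a i * (f i / a i) powr p = f i powr p * w i * d powr (p - 1)" by simp
    qed
    also have "\<dots> = (\<Sum>i\<in>R. f i powr p * w i) * d powr (p - 1)" by (simp add: sum_distrib_right)
    also have "\<dots> \<le> (\<Sum>i\<in>S. f i powr p * w i) * (\<Sum>i\<in>S. w i powr (1 - p')) powr (p - 1)"
      using R S w f p d
      by (intro mult_mono powr_mono2 sum_mono2 sum_nonneg)
        (auto simp: d_def less_imp_le intro!: sum_mono2 mult_nonneg_nonneg)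
    finally show ?thesis unfolding sumR .
  qed
qed

text \<open>The hypothesis is \<open>1 \<le> t + u\<close> rather than an equation, so that
  \<open>u\<close> may be the positive part of \<open>1 - t\<close> when \<open>t\<close> exceeds
  1.\<close>

lemma two_conductor_lower_bound:
  fixes p p' d s t u :: real
  assumes p: "1 < p" "1 / p + 1 / p' = 1"
    and "0 < d" "0 \<le> s" "0 \<le> t" "0 \<le> u" "1 \<le> t + u"
  shows "s / (1 + d * s powr (p' - 1)) powr (p - 1) \<le> t powr p * d powr (1 - p) + u powr p * s"
proof (cases "s = 0")
  \<comment> \<open>Hoelder's inequality requires positive weights, and \<open>s\<close> is one of
    them.\<close>
  case False
  with assms have s: "0 < s" by simp
  define \<sigma> where "\<sigma> = s powr (p' - 1)"
  have \<sigma>: "0 < \<sigma>" using s by (simp add: \<sigma>_def)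
  have p': "p' = p / (p - 1)" using conjugate_exponent_eq[OF p] .
  have e: "(1 - p') * (1 - p) = 1" "(1 - p) * (1 - p') = 1" "(p' - 1) * (p - 1) = 1"
    using p(1) unfolding p' by (simp_all add: field_simps)
  \<comment> \<open>The two points are the Booleans: \<open>True\<close> stands for the geodesic to
    the vertex, \<open>False\<close> for the subtrees below it.\<close>
  let ?f = "\<lambda>b. if b then t else u" and ?w = "\<lambda>b. if b then d powr (1 - p) else s"
  have "1 = 1 powr p" by simp
  also have "\<dots> \<le> (t + u) powr p" using assms by (intro powr_mono2) auto
  also have "\<dots> \<le> (t powr p * d powr (1 - p) + u powr p * s) * (d + 1 / \<sigma>) powr (p - 1)"
  proof -
    have "s powr (1 - p') = 1 / \<sigma>" by (simp add: \<sigma>_def powr_minus_divide[symmetric])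
    moreover have "(d powr (1 - p)) powr (1 - p') = d" using assms by (simp add: powr_powr e)
    ultimately show ?thesis
      using weighted_Holder_sum[OF p, of UNIV ?w ?f] assms s by (simp add: UNIV_bool add.commute)
  qed
  finally have 1: "1 \<le> (t powr p * d powr (1 - p) + u powr p * s) * (d + 1 / \<sigma>) powr (p - 1)" .
  have "d + 1 / \<sigma> = (1 + d * \<sigma>) / \<sigma>" using \<sigma> by (simp add: field_simps)
  then have "(d + 1 / \<sigma>) powr (p - 1) = (1 + d * \<sigma>) powr (p - 1) / \<sigma> powr (p - 1)"
    using \<sigma> assms by (simp add: powr_divide)
  also have "\<sigma> powr (p - 1) = s" using s by (simp add: \<sigma>_def powr_powr e)
  finally have 2: "(d + 1 / \<sigma>) powr (p - 1) = (1 + d * \<sigma>) powr (p - 1) / s" .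
  have "0 < 1 + d * \<sigma>" using \<sigma> assms by (simp add: add_pos_pos)
  then have "0 < (1 + d * \<sigma>) powr (p - 1)" by simp
  then show ?thesis using 1 s unfolding 2 \<sigma>_def[symmetric] by (simp add: field_simps)
qed (use assms in simp)

lemma two_conductor_optimum:
  fixes p p' d s :: real
  assumes p: "1 < p" "1 / p + 1 / p' = 1" and d: "0 < d" and s: "0 \<le> s"
  obtains t where "0 \<le> t" "t < 1"
    "t powr p * d powr (1 - p) + (1 - t) powr p * s = s / (1 + d * s powr (p' - 1)) powr (p - 1)"
proof
  define \<sigma> where "\<sigma> = s powr (p' - 1)"
  define D where "D = 1 + d * \<sigma>"
  \<comment> \<open>Setting the derivative in \<open>t\<close> to zero gives
    \<open>t / d = (1 - t) * \<sigma>\<close>, because \<open>p' - 1\<close> is the reciprocal of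
    \<open>p - 1\<close>; solving for \<open>t\<close> yields this value.\<close>
  let ?t = "d * \<sigma> / D"
  have \<sigma>: "0 \<le> \<sigma>" by (simp add: \<sigma>_def)
  have D: "1 \<le> D" using d \<sigma> by (simp add: D_def)
  have p': "p' = p / (p - 1)" using conjugate_exponent_eq[OF p] .
  have e: "(p' - 1) * p = 1 + (p' - 1)"
    using p(1) unfolding p' by (simp add: field_simps)
  show "0 \<le> ?t" using d \<sigma> D by simp
  show "?t < 1" using D by (simp add: D_def)
  have \<sigma>p: "\<sigma> powr p = s * \<sigma>"
  proof (cases "s = 0")
    case False
    then show ?thesis using s unfolding \<sigma>_def powr_powr e powr_add by simp
  qed (use p in \<open>simp add: \<sigma>_def\<close>)
  have "?t powr p * d powr (1 - p) = d * (s * \<sigma>) / D powr p"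
    using d \<sigma> D by (simp add: powr_divide powr_mult \<sigma>p powr_diff)
  moreover have "1 - ?t = 1 / D" using D by (simp add: D_def field_simps)
  then have "(1 - ?t) powr p * s = s / D powr p" using D by (simp add: powr_divide)
  ultimately have "?t powr p * d powr (1 - p) + (1 - ?t) powr p * s = s * D / D powr p"
    by (simp add: D_def algebra_simps add_divide_distrib)
  also have "\<dots> = s / D powr (p - 1)" using D by (simp add: powr_diff)
  finally show "?t powr p * d powr (1 - p) + (1 - ?t) powr p * s
      = s / (1 + d * s powr (p' - 1)) powr (p - 1)" by (simp add: D_def \<sigma>_def)
qed

section \<open>Infinite sums in \<open>ennreal\<close>\<close>

lemma infsum_ennreal_cmult: "(\<Sum>\<^sub>\<infinity>x\<in>A. c * f x) = c * (\<Sum>\<^sub>\<infinity>x\<in>A. f x)" for c :: ennreal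
  by (simp add: nonneg_infsum_complete SUP_mult_left_ennreal sum_distrib_left)

lemma infsum_ennreal_mono_set: "A \<subseteq> B \<Longrightarrow> infsum f A \<le> infsum f B" for f :: "'i \<Rightarrow> ennreal"
  by (intro infsum_mono_neutral nonneg_summable_on_complete) auto

lemma infsum_ennreal_UN_disjoint:
  fixes f :: "'i \<Rightarrow> ennreal"
  assumes "finite J" "disjoint_family_on A J"
  shows "infsum f (\<Union>j\<in>J. A j) = (\<Sum>j\<in>J. infsum f (A j))"
  using assms
proof (induction J)
  case (insert j J)
  then have "A j \<inter> (\<Union>i\<in>J. A i) = {}" by (auto simp: disjoint_family_on_def)
  moreover have "disjoint_family_on A J"
    using insert.prems by (rule disjoint_family_on_mono[rotated]) auto
  ultimately show ?case using insert
    by (simp add: infsum_Un_disjoint nonneg_summable_on_complete)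
qed simp

section \<open>Geodesics and the order of predecessors\<close>

lemma path_between_appendD1: "path_between E x y (xs @ z # ys) \<Longrightarrow> path_between E x z (xs @ [z])"
  by (cases xs) (auto simp: path_between_def successively_append_iff successively_Cons hd_append)

lemma path_between_appendD2: "path_between E x y (xs @ z # ys) \<Longrightarrow> path_between E z y (z # ys)"
  by (auto simp: path_between_def successively_append_iff)

lemma tree_path_unique:
  assumes "is_tree T E" "x \<in> T" "y \<in> T" "path_between E x y xs" "path_between E x y ys"
  shows "xs = ys"
  using assms unfolding is_tree_def by blast

text \<open>Every vertex on an edge belongs to \<open>T\<close>; the assumption on \<open>x\<close>
  covers the path with a single vertex, which has no edge.\<close>

lemma path_between_subset:
  assumes "is_tree T E" "x \<in> T" "path_between E x y xs"
  shows "set xs \<subseteq> T"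
proof -
  have ET: "E \<subseteq> T \<times> T" using assms(1) by (simp add: is_tree_def)
  have "successively (\<lambda>u v. (u, v) \<in> E) zs \<Longrightarrow> hd zs \<in> T \<Longrightarrow> set zs \<subseteq> T" for zs
    using ET by (induction zs rule: induct_list012) auto
  then show ?thesis using assms unfolding path_between_def by blast
qed

text \<open>Uniqueness of paths replaces the existential quantifier in \<open>predecessors\<close>
  by any one path at hand.\<close>

lemma predecessors_path:
  assumes "is_tree T E" "r \<in> T" "path_between E r x xs"
  shows "predecessors E r (Inl x) = set xs"
proof -
  have "x \<in> T" using path_between_subset[OF assms] assms(3) by (auto simp: path_between_def)
  then show ?thesis using tree_path_unique[OF assms(1,2)] assms(3)
    by (auto simp: predecessors_def)
qed

lemma tree_obtain_path:
  assumes "is_tree T E" "r \<in> T" "x \<in> T"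
  obtains xs where "path_between E r x xs" "predecessors E r (Inl x) = set xs"
  using assms predecessors_path unfolding is_tree_def by metis

lemma predecessors_self:
  assumes "is_tree T E" "r \<in> T" "x \<in> T"
  shows "x \<in> predecessors E r (Inl x)"
  using tree_obtain_path[OF assms] by (metis last_in_set path_between_def)

lemma predecessors_finite:
  assumes "is_tree T E" "r \<in> T" "x \<in> T"
  shows "finite (predecessors E r (Inl x))"
  using tree_obtain_path[OF assms] by (metis List.finite_set)

text \<open>An initial segment of a ray is injective and successively adjacent, hence it is the
  geodesic to its last vertex. This reduces boundary points to vertices.\<close>

lemma predecessors_ray:
  assumes "is_tree T E" "r \<in> T" "\<gamma> \<in> tree_boundary E r"
  shows "predecessors E r (Inl (\<gamma> n)) = \<gamma> ` {..n}"
proof -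
  have \<gamma>: "\<gamma> 0 = r" "inj \<gamma>" "\<And>k. (\<gamma> k, \<gamma> (Suc k)) \<in> E"
    using assms(3) by (auto simp: tree_boundary_def)
  have "last (map \<gamma> [0..<Suc n]) = \<gamma> n" by simp
  moreover have "inj_on \<gamma> {0..<Suc n}" using \<gamma>(2) by (rule inj_on_subset) simp
  moreover have "successively (\<lambda>u v. (u, v) \<in> E) (map \<gamma> [0..<Suc n])"
    using \<gamma>(3) by (induction n) (auto simp: successively_append_iff last_map)
  ultimately have "path_between E r (\<gamma> n) (map \<gamma> [0..<Suc n])"
    using \<gamma> by (auto simp: path_between_def distinct_map hd_map simp del: upt_Suc)
  then have "predecessors E r (Inl (\<gamma> n)) = set (map \<gamma> [0..<Suc n])"
    using predecessors_path[OF assms(1,2)] by blast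
  then show ?thesis by (simp only: set_map set_upt) (simp add: atLeast0LessThan lessThan_Suc_atMost)
qed

lemma predecessors_subset:
  assumes "is_tree T E" "r \<in> T" "\<xi> \<in> tree_closure T E r"
  shows "predecessors E r \<xi> \<subseteq> T"
proof (cases \<xi>)
  case (Inl x)
  then have "x \<in> T" using assms(3) by (auto simp: tree_closure_def)
  then show ?thesis using Inl assms(1,2) tree_obtain_path path_between_subset by metis
next
  case (Inr \<gamma>)
  then have "(\<gamma> n, \<gamma> (Suc n)) \<in> E" for n
    using assms(3) by (auto simp: tree_closure_def tree_boundary_def)
  moreover have "E \<subseteq> T \<times> T" using assms(1) by (simp add: is_tree_def)
  ultimately show ?thesis using Inr by (auto simp: predecessors_def)
qed

text \<open>An initial segment of a geodesic is the geodesic to the vertex where it ends.\<close>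

lemma predecessors_trans:
  assumes "is_tree T E" "r \<in> T" "\<xi> \<in> tree_closure T E r" "u \<in> predecessors E r \<xi>"
  shows "predecessors E r (Inl u) \<subseteq> predecessors E r \<xi>"
proof (cases \<xi>)
  case (Inl x)
  then have "x \<in> T" using assms(3) by (auto simp: tree_closure_def)
  then obtain xs where xs: "path_between E r x xs" "predecessors E r (Inl x) = set xs"
    using tree_obtain_path assms(1,2) by metis
  then obtain us vs where "xs = us @ u # vs" using assms(4) Inl by (auto dest: split_list)
  then show ?thesis
    using xs Inl path_between_appendD1[of E r x us u vs] predecessors_path[OF assms(1,2)] by auto
next
  case (Inr \<gamma>)
  then have "\<gamma> \<in> tree_boundary E r" using assms(3) by (auto simp: tree_closure_def)
  moreover have ray: "predecessors E r (Inr \<gamma>) = range \<gamma>" by (simp add: predecessors_def)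
  ultimately show ?thesis using Inr assms(4) predecessors_ray[OF assms(1,2)] ray
    by auto
qed

text \<open>Of two vertices on one geodesic, the one reached first lies on the initial segment
  ending at the other.\<close>

lemma predecessors_linear:
  assumes "is_tree T E" "r \<in> T" "\<xi> \<in> tree_closure T E r"
    and "u \<in> predecessors E r \<xi>" "v \<in> predecessors E r \<xi>"
  shows "u \<in> predecessors E r (Inl v) \<or> v \<in> predecessors E r (Inl u)"
proof (cases \<xi>)
  case (Inl x)
  then have "x \<in> T" using assms(3) by (auto simp: tree_closure_def)
  then obtain xs where xs: "path_between E r x xs" "predecessors E r (Inl x) = set xs"
    using tree_obtain_path assms(1,2) by metis
  then obtain us vs where split: "xs = us @ u # vs" using assms(4) Inl by (auto dest: split_list)
  have u: "predecessors E r (Inl u) = set (us @ [u])"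
    using xs split path_between_appendD1[of E r x us u vs] predecessors_path[OF assms(1,2)] by auto
  show ?thesis
  proof (cases "v \<in> set vs")
    case True
    then obtain vs1 vs2 where vs: "vs = vs1 @ v # vs2" by (auto dest: split_list)
    then have "path_between E r v ((us @ u # vs1) @ [v])"
      using xs split path_between_appendD1[of E r x "us @ u # vs1" v vs2] by auto
    then show ?thesis using predecessors_path[OF assms(1,2)] by auto
  next
    case False
    then show ?thesis using assms(5) Inl xs split u by auto
  qed
next
  case (Inr \<gamma>)
  then have "\<gamma> \<in> tree_boundary E r" using assms(3) by (auto simp: tree_closure_def)
  moreover have ray: "predecessors E r (Inr \<gamma>) = range \<gamma>" by (simp add: predecessors_def)
  ultimately show ?thesis using Inr assms(4,5) predecessors_ray[OF assms(1,2)] ray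
    by auto (metis atMost_iff image_eqI linear)
qed

section \<open>Children and the subtrees below them\<close>

lemma children_in_tree: "is_tree T E \<Longrightarrow> y \<in> children E r x \<Longrightarrow> y \<in> T"
  by (auto simp: is_tree_def children_def)

text \<open>The edge is the only path from \<open>x\<close> to \<open>y\<close>, so the geodesic to
  \<open>y\<close>, which passes through \<open>x\<close>, must end with that edge.\<close>

lemma predecessors_child:
  assumes "is_tree T E" "r \<in> T" "y \<in> children E r x"
  shows "predecessors E r (Inl y) = insert y (predecessors E r (Inl x))"
    and "y \<notin> predecessors E r (Inl x)"
proof -
  have E: "(x, y) \<in> E" and x: "x \<in> predecessors E r (Inl y)"
    using assms(3) by (auto simp: children_def)
  have T: "x \<in> T" "y \<in> T" and ne: "x \<noteq> y"
    using E assms(1) by (auto simp: is_tree_def irrefl_def)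
  obtain ys where ys: "path_between E r y ys" "predecessors E r (Inl y) = set ys"
    using tree_obtain_path T(2) assms(1,2) by metis
  then obtain us vs where split: "ys = us @ x # vs" using x by (auto dest: split_list)
  have "path_between E x y (x # vs)" using path_between_appendD2 ys split by metis
  moreover have "path_between E x y [x, y]" using E ne by (auto simp: path_between_def)
  ultimately have "x # vs = [x, y]" by (rule tree_path_unique[OF assms(1) T])
  then have ys': "ys = (us @ [x]) @ [y]" using split by simp
  have "path_between E r x (us @ [x])"
    using ys(1) split path_between_appendD1[of E r y us x vs] by simp
  then have px: "predecessors E r (Inl x) = set (us @ [x])"
    using predecessors_path[OF assms(1,2)] by blast
  show "predecessors E r (Inl y) = insert y (predecessors E r (Inl x))"
    using px ys(2) ys' by auto
  show "y \<notin> predecessors E r (Inl x)"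
    using px ys(1) ys' by (auto simp: path_between_def)
qed

lemma successor_vertices_iff:
  "z \<in> successor_vertices T E r y \<longleftrightarrow> z \<in> T \<and> y \<in> predecessors E r (Inl z)"
  by (auto simp: successor_vertices_def successors_def tree_closure_def)

text \<open>A common vertex would, by transitivity, put \<open>y\<close> among the predecessors of
  its own parent.\<close>

lemma child_successors_disjoint_predecessors:
  assumes "is_tree T E" "r \<in> T" "x \<in> T" "y \<in> children E r x"
  shows "predecessors E r (Inl x) \<inter> successor_vertices T E r y = {}"
proof -
  have "Inl x \<in> tree_closure T E r" using assms(3) by (simp add: tree_closure_def)
  then show ?thesis
    using predecessors_trans[OF assms(1,2)] predecessors_child(2)[OF assms(1,2,4)]
    by (fastforce simp: successor_vertices_iff)
qed

text \<open>Two distinct children above the same vertex would be comparable, so one of them would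
  precede the other and hence already precede \<open>x\<close>.\<close>

lemma children_successors_disjoint:
  assumes "is_tree T E" "r \<in> T"
  shows "disjoint_family_on (successor_vertices T E r) (children E r x)"
proof -
  have False if y: "y \<in> children E r x" and y': "y' \<in> children E r x" and ne: "y \<noteq> y'"
    and z: "z \<in> T" "y \<in> predecessors E r (Inl z)" "y' \<in> predecessors E r (Inl z)" for y y' z
  proof -
    have "Inl z \<in> tree_closure T E r" using z(1) by (simp add: tree_closure_def)
    from predecessors_linear[OF assms this z(2,3)] show False
      using predecessors_child[OF assms y] predecessors_child[OF assms y'] ne by auto
  qed
  then show ?thesis unfolding disjoint_family_on_def
    by (auto simp: successor_vertices_iff)
qed

text \<open>Each vertex of the geodesic is comparable with \<open>y\<close>: strictly before
  \<open>y\<close> it precedes \<open>x\<close>, and from \<open>y\<close> on it lies in the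
  subtree.\<close>

lemma predecessors_decomp:
  assumes "is_tree T E" "r \<in> T" "y \<in> children E r x" "\<xi> \<in> successors T E r y"
  shows "predecessors E r \<xi> =
    predecessors E r (Inl x) \<union> (predecessors E r \<xi> \<inter> successor_vertices T E r y)"
proof -
  have \<xi>: "\<xi> \<in> tree_closure T E r" "y \<in> predecessors E r \<xi>"
    using assms(4) by (auto simp: successors_def)
  have "u \<in> predecessors E r (Inl x) \<or> u \<in> successor_vertices T E r y"
    if "u \<in> predecessors E r \<xi>" for u
  proof -
    have "u \<in> T" using that predecessors_subset[OF assms(1,2) \<xi>(1)] by auto
    then show ?thesis
      using predecessors_linear[OF assms(1,2) \<xi>(1) that \<xi>(2)]
        predecessors_child(1)[OF assms(1-3)] children_in_tree[OF assms(1,3)]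
        predecessors_self[OF assms(1,2)]
      by (auto simp: successor_vertices_iff)
  qed
  moreover have "predecessors E r (Inl x) \<subseteq> predecessors E r \<xi>"
    using predecessors_trans[OF assms(1,2) \<xi>] predecessors_child(1)[OF assms(1-3)] by auto
  ultimately show ?thesis by auto
qed

section \<open>The capacity formula at a vertex and its children\<close>

theorem theorem30:
  fixes T :: "'a set" and E :: "('a \<times> 'a) set" and r x\<^sub>0 :: 'a and N :: nat
    and w :: "'a \<Rightarrow> real" and p p' :: real and Z :: "('a + (nat \<Rightarrow> 'a)) set"
  assumes "rooted_tree T E r N"
    and "\<forall>x\<in>T. 0 < w x"
    and "1 < p" and "1 / p + 1 / p' = 1"
    and "x\<^sub>0 \<in> T"
    and "Z \<subseteq> tree_closure T E r"
    and "Z \<subseteq> (\<Union>y\<in>children E r x\<^sub>0. successors T E r y)"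
  defines "s \<equiv> (\<Sum>y\<in>children E r x\<^sub>0. enn2real (capacity_at T E r p w y (Z \<inter> successors T E r y)))"
  shows "capacity T E r p w Z =
    ennreal (s / (1 + d_weight E r p' w x\<^sub>0 * s powr (p' - 1)) powr (p - 1))"
proof -
  note p = assms(3,4) and Zsub = assms(7)
  have tree: "is_tree T E" and r: "r \<in> T" and J: "finite (children E r x\<^sub>0)"
    using assms(1,5) by (auto simp: rooted_tree_def)
  define P where "P = predecessors E r (Inl x\<^sub>0)"
  define J where "J = children E r x\<^sub>0"
  define V where "V = successor_vertices T E r"
  define c where "c y = enn2real (capacity_at T E r p w y (Z \<inter> successors T E r y))" for y
  define d where "d = d_weight E r p' w x\<^sub>0"
  have finJ: "finite J" using J by (simp add: J_def)
  \<comment> \<open>Finiteness of the capacities below the children undoes the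
    \<open>enn2real\<close> in \<open>s\<close>.\<close>
  have cap: "capacity_at T E r p w y (Z \<inter> successors T E r y) = ennreal (c y)" if "y \<in> J" for y
    using capacity_at_finite[OF assms(1) children_in_tree[OF tree]] that
    by (simp add: c_def J_def)
  have s: "s = (\<Sum>y\<in>J. c y)" by (simp add: s_def c_def J_def)
  have c0: "0 \<le> c y" for y by (simp add: c_def)
  have s0: "0 \<le> s" by (simp add: s sum_nonneg c0)
  have P: "finite P" "P \<subseteq> T" "x\<^sub>0 \<in> P"
    using predecessors_finite[OF tree r assms(5)] predecessors_self[OF tree r assms(5)]
      predecessors_subset[OF tree r, of "Inl x\<^sub>0"] assms(5)
    by (auto simp: P_def tree_closure_def)
  have VT: "V y \<subseteq> T" for y by (auto simp: V_def successor_vertices_iff)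
  have PV: "P \<inter> V y = {}" if "y \<in> J" for y
    using child_successors_disjoint_predecessors[OF tree r assms(5)] that by (simp add: P_def V_def J_def)
  have VV: "disjoint_family_on V J"
    unfolding V_def J_def by (rule children_successors_disjoint[OF tree r])
  have w: "0 < w x" if "x \<in> T" for x using assms(2) that by auto
  have d: "d = (\<Sum>y\<in>P. w y powr (1 - p'))" by (simp add: d_def d_weight_def P_def)
  have d0: "0 < d" unfolding d using P w by (intro sum_pos) (auto simp: less_imp_neq[symmetric] subset_iff)
  \<comment> \<open>Since \<open>P\<close> is finite, its share of the sum is a real number; only
    the part in the subtree can be infinite.\<close>
  have decomp: "(\<Sum>\<^sub>\<infinity>x\<in>predecessors E r \<xi>. ennreal (\<phi> x)) =
      ennreal (\<Sum>x\<in>P. \<phi> x) + (\<Sum>\<^sub>\<infinity>x\<in>predecessors E r \<xi> \<inter> V y. ennreal (\<phi> x))"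
    if y: "y \<in> J" and \<xi>: "\<xi> \<in> successors T E r y" and \<phi>: "\<forall>x\<in>T. 0 \<le> \<phi> x" for \<xi> \<phi> y
  proof -
    have "(\<Sum>\<^sub>\<infinity>x\<in>predecessors E r \<xi>. ennreal (\<phi> x)) =
      (\<Sum>\<^sub>\<infinity>x\<in>P. ennreal (\<phi> x)) + (\<Sum>\<^sub>\<infinity>x\<in>predecessors E r \<xi> \<inter> V y. ennreal (\<phi> x))"
      using predecessors_decomp[OF tree r _ \<xi>, of x\<^sub>0] y PV[OF y]
      by (subst infsum_Un_disjoint[symmetric]) (auto simp: J_def P_def V_def nonneg_summable_on_complete)
    also have "(\<Sum>\<^sub>\<infinity>x\<in>P. ennreal (\<phi> x)) = ennreal (\<Sum>x\<in>P. \<phi> x)"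
      using P \<phi> by (simp add: subset_iff sum_ennreal)
    finally show ?thesis .
  qed
  have energy: "(\<Sum>\<^sub>\<infinity>x\<in>P \<union> (\<Union>y\<in>J. V y). ennreal (\<phi> x powr p * w x)) =
      ennreal (\<Sum>x\<in>P. \<phi> x powr p * w x) + (\<Sum>y\<in>J. \<Sum>\<^sub>\<infinity>x\<in>V y. ennreal (\<phi> x powr p * w x))" for \<phi>
  proof -
    have "P \<inter> (\<Union>y\<in>J. V y) = {}" using PV by auto
    moreover have "(\<Sum>x\<in>P. ennreal (\<phi> x powr p * w x)) = ennreal (\<Sum>x\<in>P. \<phi> x powr p * w x)"
      using P w by (intro sum_ennreal) (auto simp: less_imp_le)
    ultimately show ?thesis
      using P(1) by (simp add: infsum_Un_disjoint nonneg_summable_on_complete infsum_ennreal_UN_disjoint[OF finJ VV])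
  qed
  have scale: "(\<Sum>\<^sub>\<infinity>x\<in>A. ennreal ((k * \<phi> x) powr p * w x)) =
      ennreal (k powr p) * (\<Sum>\<^sub>\<infinity>x\<in>A. ennreal (\<phi> x powr p * w x))"
    if "0 \<le> k" "\<forall>x\<in>A. 0 \<le> \<phi> x" "A \<subseteq> T" for k \<phi> A
  proof -
    have "(\<Sum>\<^sub>\<infinity>x\<in>A. ennreal ((k * \<phi> x) powr p * w x)) =
        (\<Sum>\<^sub>\<infinity>x\<in>A. ennreal (k powr p) * ennreal (\<phi> x powr p * w x))"
      using that w
      by (intro infsum_cong) (auto simp: powr_mult mult.assoc subset_iff less_imp_le simp flip: ennreal_mult)
    then show ?thesis by (simp add: infsum_ennreal_cmult)
  qed
  let ?c = "s / (1 + d * s powr (p' - 1)) powr (p - 1)"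
  have "ennreal ?c \<le> capacity T E r p w Z"
    unfolding capacity_def
  proof (intro INF_greatest, clarify)
    fix \<phi> :: "'a \<Rightarrow> real"
    assume \<phi>: "\<forall>x\<in>T. 0 \<le> \<phi> x" and adm: "\<forall>\<xi>\<in>Z. 1 \<le> (\<Sum>\<^sub>\<infinity>y\<in>predecessors E r \<xi>. ennreal (\<phi> y))"
    define t where "t = (\<Sum>x\<in>P. \<phi> x)"
    \<comment> \<open>If \<open>t\<close> is at least 1, admissibility demands nothing of the
      subtrees; then \<open>u = 0\<close> and the bound \<open>Vy\<close> is trivial.\<close>
    define u where "u = max 0 (1 - t)"
    have t0: "0 \<le> t" unfolding t_def using P \<phi> by (intro sum_nonneg) auto
    have Vy: "ennreal (u powr p * c y) \<le> (\<Sum>\<^sub>\<infinity>x\<in>V y. ennreal (\<phi> x powr p * w x))" if y: "y \<in> J" for y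
    proof (cases "t < 1")
      case True
      then have u: "u = 1 - t" "0 < u" by (auto simp: u_def)
      have "ennreal (c y) \<le> (\<Sum>\<^sub>\<infinity>x\<in>V y. ennreal ((1 / u * \<phi> x) powr p * w x))"
        unfolding cap[OF y, symmetric] capacity_at_def V_def[symmetric]
      proof (intro INF_lower, clarify, intro conjI ballI)
        fix x assume "x \<in> V y"
        then show "0 \<le> 1 / u * \<phi> x" using \<phi> VT[of y] u(2) by (auto simp: subset_iff)
      next
        fix \<xi> assume \<xi>: "\<xi> \<in> Z \<inter> successors T E r y"
        let ?S = "\<Sum>\<^sub>\<infinity>x\<in>predecessors E r \<xi> \<inter> V y. ennreal (\<phi> x)"
        have "ennreal t + ennreal u = 1" using t0 u by (simp flip: ennreal_plus)
        then have "ennreal t + ennreal u \<le> ennreal t + ?S"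
          using adm \<xi> decomp[OF y _ \<phi>, of \<xi>] by (auto simp: t_def)
        \<comment> \<open>Cancelling \<open>ennreal t\<close> is allowed because it is
          finite.\<close>
        then have "ennreal u \<le> ?S" by (simp only: ennreal_add_left_cancel_le) auto
        then have "ennreal (1 / u) * ennreal u \<le> ennreal (1 / u) * ?S" by (intro mult_left_mono) auto
        also have "ennreal (1 / u) * ennreal u = 1" using u by (simp flip: ennreal_mult)
        also have "ennreal (1 / u) * ?S = (\<Sum>\<^sub>\<infinity>x\<in>predecessors E r \<xi> \<inter> V y. ennreal (1 / u * \<phi> x))"
          unfolding infsum_ennreal_cmult[symmetric]
          using u \<phi> VT by (intro infsum_cong) (auto simp: subset_iff simp flip: ennreal_mult)
        finally show "1 \<le> (\<Sum>\<^sub>\<infinity>x\<in>predecessors E r \<xi> \<inter> V y. ennreal (1 / u * \<phi> x))" .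
      qed
      also have "\<dots> = ennreal ((1 / u) powr p) * (\<Sum>\<^sub>\<infinity>x\<in>V y. ennreal (\<phi> x powr p * w x))"
        using u \<phi> VT by (intro scale) auto
      finally have "ennreal (u powr p) * ennreal (c y) \<le>
          ennreal (u powr p) * (ennreal ((1 / u) powr p) * (\<Sum>\<^sub>\<infinity>x\<in>V y. ennreal (\<phi> x powr p * w x)))"
        by (intro mult_left_mono) auto
      also have "\<dots> = (\<Sum>\<^sub>\<infinity>x\<in>V y. ennreal (\<phi> x powr p * w x))"
        using u by (simp add: mult.assoc[symmetric] powr_divide flip: ennreal_mult)
      finally show ?thesis by (simp add: ennreal_mult c0)
    qed (simp add: u_def)
    let ?A = "\<Sum>x\<in>P. \<phi> x powr p * w x"
    have A0: "0 \<le> ?A" using P w by (intro sum_nonneg) (auto simp: less_imp_le)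
    have "t powr p \<le> ?A * d powr (p - 1)"
      unfolding t_def d using P w \<phi> by (intro weighted_Holder_sum[OF p]) auto
    then have "t powr p * d powr (1 - p) \<le> ?A * d powr (p - 1) * d powr (1 - p)"
      by (intro mult_right_mono) auto
    also have "\<dots> = ?A" using d0 by (simp add: mult.assoc flip: powr_add)
    finally have "t powr p * d powr (1 - p) \<le> ?A" .
    moreover have "?c \<le> t powr p * d powr (1 - p) + u powr p * s"
      by (rule two_conductor_lower_bound[OF p d0 s0 t0]) (auto simp: u_def)
    ultimately have "?c \<le> ?A + u powr p * s" by simp
    then have "ennreal ?c \<le> ennreal (?A + u powr p * s)" by (rule ennreal_leI)
    also have "\<dots> = ennreal ?A + (\<Sum>y\<in>J. ennreal (u powr p * c y))"
      using A0 s0 c0 by (simp add: s sum_distrib_left sum_ennreal sum_nonneg ennreal_plus)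
    also have "\<dots> \<le> ennreal ?A + (\<Sum>y\<in>J. \<Sum>\<^sub>\<infinity>x\<in>V y. ennreal (\<phi> x powr p * w x))"
      using Vy by (intro add_left_mono sum_mono)
    \<comment> \<open>Energy spent outside \<open>P\<close> and the subtrees can only increase the
      total.\<close>
    also have "\<dots> \<le> (\<Sum>\<^sub>\<infinity>x\<in>T. ennreal (\<phi> x powr p * w x))"
      unfolding energy[symmetric] using P VT by (intro infsum_ennreal_mono_set) auto
    finally show "ennreal ?c \<le> (\<Sum>\<^sub>\<infinity>x\<in>T. ennreal (\<phi> x powr p * w x))" .
  qed
  moreover have "capacity T E r p w Z \<le> ennreal ?c"
  proof (rule ennreal_le_epsilon)
    fix \<epsilon> :: real
    assume \<epsilon>: "0 < \<epsilon>"
    \<comment> \<open>The infima below the children need not be attained, so each child gets an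
      error \<open>\<delta>\<close>, with total at most \<open>\<epsilon>\<close>; the
      \<open>+ 1\<close> keeps the denominator positive.\<close>
    define \<delta> where "\<delta> = \<epsilon> / (real (card J) + 1)"
    have \<delta>: "0 < \<delta>" "card J * \<delta> \<le> \<epsilon>" using \<epsilon> by (auto simp: \<delta>_def field_simps)
    obtain t where t: "0 \<le> t" "t < 1" and t_opt: "t powr p * d powr (1 - p) + (1 - t) powr p * s = ?c"
      using two_conductor_optimum[OF p d0 s0] .
    have "\<forall>y\<in>J. \<exists>f. (\<forall>x\<in>V y. 0 \<le> f x) \<and>
        (\<forall>\<xi>\<in>Z \<inter> successors T E r y. 1 \<le> (\<Sum>\<^sub>\<infinity>x\<in>predecessors E r \<xi> \<inter> V y. ennreal (f x))) \<and>
        (\<Sum>\<^sub>\<infinity>x\<in>V y. ennreal (f x powr p * w x)) < ennreal (c y + \<delta>)"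
    proof
      fix y assume y: "y \<in> J"
      have "capacity_at T E r p w y (Z \<inter> successors T E r y) < ennreal (c y + \<delta>)"
        unfolding cap[OF y] using \<delta> c0 by (simp add: ennreal_lessI)
      then show "\<exists>f. (\<forall>x\<in>V y. 0 \<le> f x) \<and>
          (\<forall>\<xi>\<in>Z \<inter> successors T E r y. 1 \<le> (\<Sum>\<^sub>\<infinity>x\<in>predecessors E r \<xi> \<inter> V y. ennreal (f x))) \<and>
          (\<Sum>\<^sub>\<infinity>x\<in>V y. ennreal (f x powr p * w x)) < ennreal (c y + \<delta>)"
        unfolding capacity_at_def V_def[symmetric] INF_less_iff by blast
    qed
    from bchoice[OF this] obtain f where f0: "\<And>y x. y \<in> J \<Longrightarrow> x \<in> V y \<Longrightarrow> 0 \<le> f y x"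
      and f1: "\<And>y \<xi>. y \<in> J \<Longrightarrow> \<xi> \<in> Z \<inter> successors T E r y \<Longrightarrow>
        1 \<le> (\<Sum>\<^sub>\<infinity>x\<in>predecessors E r \<xi> \<inter> V y. ennreal (f y x))"
      and f2: "\<And>y. y \<in> J \<Longrightarrow> (\<Sum>\<^sub>\<infinity>x\<in>V y. ennreal (f y x powr p * w x)) < ennreal (c y + \<delta>)"
      by blast
    \<comment> \<open>On \<open>P\<close> this is the extremal function of Hoelder's inequality,
      normalized to total \<open>t\<close>; below each child it is a near-minimizer scaled by
      \<open>1 - t\<close>. The description operator picks the child, which is unique because the
      subtrees are disjoint.\<close>
    define \<phi> where "\<phi> x = (if x \<in> P then t / d * w x powr (1 - p')
      else if \<exists>y\<in>J. x \<in> V y then (1 - t) * f (THE y. y \<in> J \<and> x \<in> V y) x else 0)" for x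
    have \<phi>P: "\<phi> x = t / d * w x powr (1 - p')" if "x \<in> P" for x using that by (simp add: \<phi>_def)
    have \<phi>V: "\<phi> x = (1 - t) * f y x" if "y \<in> J" "x \<in> V y" for x y
    proof -
      have "(THE y. y \<in> J \<and> x \<in> V y) = y"
        using that VV by (intro the_equality) (auto simp: disjoint_family_on_def)
      then show ?thesis using that PV by (auto simp: \<phi>_def)
    qed
    have \<phi>0: "\<phi> x = 0" if "x \<notin> P \<union> (\<Union>y\<in>J. V y)" for x using that by (auto simp: \<phi>_def)
    have \<phi>nn: "0 \<le> \<phi> x" for x
    proof -
      consider "x \<in> P" | y where "y \<in> J" "x \<in> V y" | "x \<notin> P \<union> (\<Union>y\<in>J. V y)" by auto
      then show ?thesis using \<phi>P \<phi>V \<phi>0 f0 t d0 by cases simp_all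
    qed
    have sumP: "(\<Sum>x\<in>P. \<phi> x) = t"
    proof -
      have "(\<Sum>x\<in>P. \<phi> x) = t / d * d" unfolding d sum_distrib_left using \<phi>P by (simp add: d)
      then show ?thesis using d0 by simp
    qed
    have adm: "1 \<le> (\<Sum>\<^sub>\<infinity>x\<in>predecessors E r \<xi>. ennreal (\<phi> x))" if "\<xi> \<in> Z" for \<xi>
    proof -
      \<comment> \<open>By \<open>Zsub\<close> every point of \<open>Z\<close> lies below some
        child, whose near-minimizer supplies the missing \<open>1 - t\<close>.\<close>
      obtain y where y: "y \<in> J" "\<xi> \<in> successors T E r y" using \<open>\<xi> \<in> Z\<close> Zsub by (auto simp: J_def)
      have "1 = ennreal t + ennreal (1 - t) * 1" using t by (simp flip: ennreal_plus)
      also have "\<dots> \<le> ennreal t + ennreal (1 - t) * (\<Sum>\<^sub>\<infinity>x\<in>predecessors E r \<xi> \<inter> V y. ennreal (f y x))"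
        using f1[of y \<xi>] y \<open>\<xi> \<in> Z\<close> by (intro add_left_mono mult_left_mono) auto
      also have "\<dots> = ennreal t + (\<Sum>\<^sub>\<infinity>x\<in>predecessors E r \<xi> \<inter> V y. ennreal (\<phi> x))"
        unfolding infsum_ennreal_cmult[symmetric] using y t f0
        by (intro arg_cong2[where f = "(+)"] refl infsum_cong) (auto simp: \<phi>V simp flip: ennreal_mult)
      also have "\<dots> = (\<Sum>\<^sub>\<infinity>x\<in>predecessors E r \<xi>. ennreal (\<phi> x))"
        using decomp[OF y] \<phi>nn by (simp add: sumP)
      finally show ?thesis .
    qed
    \<comment> \<open>With this exponent identity the energy density on \<open>P\<close> is again
      proportional to \<open>w x powr (1 - p')\<close>, so it sums to a multiple of
      \<open>d\<close>.\<close>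
    have ePP: "(1 - p') * p + 1 = 1 - p'"
      using p(1) unfolding conjugate_exponent_eq[OF p] by (simp add: field_simps)
    have "(\<Sum>x\<in>P. \<phi> x powr p * w x) = (\<Sum>x\<in>P. (t / d) powr p * w x powr (1 - p'))"
    proof (intro sum.cong refl)
      fix x assume x: "x \<in> P"
      then have wx: "0 < w x" using P w by auto
      have "\<phi> x powr p * w x = (t / d) powr p * (w x powr ((1 - p') * p) * w x powr 1)"
        using x wx t d0 by (simp add: \<phi>P powr_mult powr_divide powr_powr)
      also have "\<dots> = (t / d) powr p * w x powr (1 - p')"
        by (simp only: powr_add[symmetric] ePP)
      finally show "\<phi> x powr p * w x = (t / d) powr p * w x powr (1 - p')" .
    qed
    also have "\<dots> = (t / d) powr p * d" by (simp only: d sum_distrib_left)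
    also have "\<dots> = t powr p * d powr (1 - p)" using t d0 by (simp add: powr_divide powr_diff)
    finally have eP: "(\<Sum>x\<in>P. \<phi> x powr p * w x) = t powr p * d powr (1 - p)" .
    have eV: "(\<Sum>\<^sub>\<infinity>x\<in>V y. ennreal (\<phi> x powr p * w x)) \<le> ennreal ((1 - t) powr p * c y + \<delta>)"
      if y: "y \<in> J" for y
    proof -
      \<comment> \<open>The scaling factor is at most 1, so the error \<open>\<delta>\<close> can be
        kept unscaled.\<close>
      have le1: "(1 - t) powr p \<le> 1" using t p by (intro powr_le1) auto
      have "(\<Sum>\<^sub>\<infinity>x\<in>V y. ennreal (\<phi> x powr p * w x)) =
          (\<Sum>\<^sub>\<infinity>x\<in>V y. ennreal (((1 - t) * f y x) powr p * w x))"
        using y by (intro infsum_cong) (simp add: \<phi>V)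
      also have "\<dots> = ennreal ((1 - t) powr p) * (\<Sum>\<^sub>\<infinity>x\<in>V y. ennreal (f y x powr p * w x))"
        using y t f0 VT by (intro scale) auto
      also have "\<dots> \<le> ennreal ((1 - t) powr p) * ennreal (c y + \<delta>)"
        using f2[OF y] by (intro mult_left_mono) auto
      also have "\<dots> = ennreal ((1 - t) powr p * c y + (1 - t) powr p * \<delta>)"
        using c0 \<delta> by (simp add: algebra_simps flip: ennreal_mult)
      also have "\<dots> \<le> ennreal ((1 - t) powr p * c y + \<delta>)"
        using \<delta> le1 by (intro ennreal_leI) (simp add: mult_le_cancel_right1)
      finally show ?thesis .
    qed
    have "(\<Sum>y\<in>J. ennreal ((1 - t) powr p * c y + \<delta>)) = ennreal ((1 - t) powr p * s + card J * \<delta>)"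
      using c0 \<delta> by (subst sum_ennreal) (simp_all add: s sum.distrib sum_distrib_left)
    then have total: "ennreal (t powr p * d powr (1 - p)) + (\<Sum>y\<in>J. ennreal ((1 - t) powr p * c y + \<delta>))
        = ennreal (?c + card J * \<delta>)"
      using s0 \<delta> unfolding t_opt[symmetric] by (simp add: add.assoc flip: ennreal_plus)
    have "capacity T E r p w Z \<le> (\<Sum>\<^sub>\<infinity>x\<in>T. ennreal (\<phi> x powr p * w x))"
      unfolding capacity_def using \<phi>nn adm by (intro INF_lower) auto
    \<comment> \<open>Elsewhere \<open>\<phi>\<close> vanishes, and
      \<open>0 powr p = 0\<close>.\<close>
    also have "\<dots> = (\<Sum>\<^sub>\<infinity>x\<in>P \<union> (\<Union>y\<in>J. V y). ennreal (\<phi> x powr p * w x))"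
      using P VT \<phi>0 by (intro infsum_cong_neutral) auto
    also have "\<dots> = ennreal (t powr p * d powr (1 - p)) + (\<Sum>y\<in>J. \<Sum>\<^sub>\<infinity>x\<in>V y. ennreal (\<phi> x powr p * w x))"
      by (simp only: energy eP)
    also have "\<dots> \<le> ennreal (t powr p * d powr (1 - p)) + (\<Sum>y\<in>J. ennreal ((1 - t) powr p * c y + \<delta>))"
      using eV by (intro add_left_mono sum_mono)
    also have "\<dots> = ennreal (?c + card J * \<delta>)" by (rule total)
    also have "\<dots> \<le> ennreal (?c + \<epsilon>)" using \<delta> by (intro ennreal_leI) simp
    also have "\<dots> = ennreal ?c + ennreal \<epsilon>" using s0 \<epsilon> by (intro ennreal_plus) auto
    finally show "capacity T E r p w Z \<le> ennreal ?c + ennreal \<epsilon>" .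
  qed
  ultimately show ?thesis unfolding d_def by (rule antisym[rotated])
qed

end
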